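(* Let $n\ge 1$, let $X$ be a compact $n$-polyhedral length space and let $\rho:X\to(0,\infty)$ be a continuous function. Suppose that $X$ does not $\rho$-collapse. Then there exists $x_0\in X$ such that $$\mathcal H_n(B_X(x_0,r))\ \ge\ c_n\, r^n\qquad\text{for every } r\in[0,\rho(x_0)],$$ where $c_n=\frac{1}{n!}\prod_{i=1}^n\lambda_i$ with $\lambda_i=\frac{v_i}{2v_{i-1}}$.
   Context: A compact $n$-polyhedral length space is a finite simplicial $n$-complex endowed with an intrinsic metric (length structure). $B_X(x,r)$ denotes the (open) ball of radius $r$ centered at $x$ in $X$. $\mathcal H_n$ is the $n$-dimensional Hausdorff measure, and $v_i$ is the volume of the unit ball in $\mathbb R^i$ (with $v_0=1$), so $\lambda_1=1$. $\mathcal H_n$ is normalized so that it agrees with Lebesgue measure on $\mathbb R^n$. Given a function $\rho:X\to(0,\infty)$, the space $X$ $\rho$-collapses if there exists a continuous map $\pi:X\to P$ to a finite simplicial $(n-1)$-complex $P$ such that every fiber of $\pi$ lies in a ball $B_X(x,\rho(x))$ for some $x\in X$. *)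

theory Defs
  imports "HOL-Analysis.Analysis"
begin

text \<open>
  Finite simplicial complexes are given combinatorially, so that one can quantify over complexes
  of all dimensions (and embedding dimensions) inside a formula: a finite set of nonempty finite
  sets of vertices (the simplices), closed under passing to nonempty subsets.
  As the complexes are finite, natural numbers suffice as vertices.
\<close>

definition finite_simplicial_complex :: "nat set set \<Rightarrow> bool" where
  "finite_simplicial_complex K \<longleftrightarrow>
     finite K \<and>
     (\<forall>\<sigma>\<in>K. finite \<sigma> \<and> \<sigma> \<noteq> {}) \<and>
     (\<forall>\<sigma>\<in>K. \<forall>\<tau>. \<tau> \<subseteq> \<sigma> \<and> \<tau> \<noteq> {} \<longrightarrow> \<tau> \<in> K)"

definition finite_simplicial_n_complex :: "nat \<Rightarrow> nat set set \<Rightarrow> bool" where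
  "finite_simplicial_n_complex n K \<longleftrightarrow>
     finite_simplicial_complex K \<and>
     (\<forall>\<sigma>\<in>K. card \<sigma> \<le> n + 1) \<and> (\<exists>\<sigma>\<in>K. card \<sigma> = n + 1)"

text \<open>
  The underlying space, in barycentric coordinates. Its topology is that of the product space
  \<^typ>\<open>nat \<Rightarrow> real\<close>; since only finitely many coordinates occur, this is the usual one.
\<close>

definition geometric_realization :: "nat set set \<Rightarrow> (nat \<Rightarrow> real) set" where
  "geometric_realization K =
     {f. (\<forall>i. 0 \<le> f i) \<and> {i. f i \<noteq> 0} \<in> K \<and> (\<Sum>i\<in>{i. f i \<noteq> 0}. f i) = 1}"

definition curve_length :: "(real \<Rightarrow> 'a::metric_space) \<Rightarrow> ennreal" where
  "curve_length \<gamma> =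
     (SUP (N, t) \<in> {(N::nat, t::nat \<Rightarrow> real). mono_on {..N} t \<and> t ` {..N} \<subseteq> {0..1}}.
        \<Sum>i<N. ennreal (dist (\<gamma> (t i)) (\<gamma> (t (Suc i)))))"

text \<open>
  The metric of the type, restricted to \<open>X\<close>, is intrinsic. As distances are finite, such an
  \<open>X\<close> is connected by curves of finite length (the infimum over no curves is \<open>\<infinity>\<close>).
\<close>

definition intrinsic_metric_on :: "'a::metric_space set \<Rightarrow> bool" where
  "intrinsic_metric_on X \<longleftrightarrow>
     (\<forall>x\<in>X. \<forall>y\<in>X. ennreal (dist x y) =
        (INF \<gamma> \<in> {\<gamma>. path \<gamma> \<and> path_image \<gamma> \<subseteq> X \<and> pathstart \<gamma> = x \<and> pathfinish \<gamma> = y}.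
           curve_length \<gamma>))"

text \<open>
  The simplicial structure is a homeomorphism with the underlying space of a complex. Neither the
  simplices nor the restriction of the metric to them are required to be flat or smooth.
\<close>

definition compact_polyhedral_length_space :: "nat \<Rightarrow> 'a::metric_space set \<Rightarrow> bool" where
  "compact_polyhedral_length_space n X \<longleftrightarrow>
     (\<exists>K. finite_simplicial_n_complex n K \<and> X homeomorphic geometric_realization K) \<and>
     intrinsic_metric_on X"

text \<open>
  Hausdorff (outer) measure. The weight $v_n (\mathrm{diam}\,U / 2)^n$ is the volume of a Euclidean
  $n$-ball with the diameter of $U$; this is the normalization for which the measure agrees with
  Lebesgue measure on $\mathbb{R}^n$ (by the isodiametric inequality). The empty set has weight
  $0$ also for $n = 0$, where \<open>0 ^ 0 = 1\<close>. Boundedness is required in the covers because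
  \<^const>\<open>diameter\<close> is unspecified on unbounded sets.
\<close>

definition hausdorff_weight :: "nat \<Rightarrow> 'a::metric_space set \<Rightarrow> ennreal" where
  "hausdorff_weight n U =
     (if U = {} then 0 else ennreal (unit_ball_vol (real n) * (diameter U / 2) ^ n))"

definition hausdorff_premeasure :: "nat \<Rightarrow> real \<Rightarrow> 'a::metric_space set \<Rightarrow> ennreal" where
  "hausdorff_premeasure n \<delta> A =
     (INF U \<in> {U :: nat \<Rightarrow> 'a set. A \<subseteq> (\<Union>i. U i) \<and> (\<forall>i. bounded (U i) \<and> diameter (U i) \<le> \<delta>)}.
        \<Sum>i. hausdorff_weight n (U i))"

definition hausdorff_measure :: "nat \<Rightarrow> 'a::metric_space set \<Rightarrow> ennreal" where
  "hausdorff_measure n A = (SUP \<delta>\<in>{0<..}. hausdorff_premeasure n \<delta> A)"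

text \<open>\<open>n - 1\<close> is truncated; this notion is meant for \<open>n \<ge> 1\<close>.\<close>

definition rho_collapses :: "nat \<Rightarrow> 'a::metric_space set \<Rightarrow> ('a \<Rightarrow> real) \<Rightarrow> bool" where
  "rho_collapses n X \<rho> \<longleftrightarrow>
     (\<exists>K. \<exists>\<pi> :: 'a \<Rightarrow> nat \<Rightarrow> real.
        finite_simplicial_n_complex (n - 1) K \<and>
        continuous_on X \<pi> \<and> \<pi> ` X \<subseteq> geometric_realization K \<and>
        (\<forall>p\<in>geometric_realization K. \<exists>x\<in>X. {y \<in> X. \<pi> y = p} \<subseteq> X \<inter> ball x (\<rho> x)))"

definition lam :: "nat \<Rightarrow> real" where
  "lam i = unit_ball_vol (real i) / (2 * unit_ball_vol (real (i - 1)))"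

definition c_const :: "nat \<Rightarrow> real" where
  "c_const n = 1 / fact n * (\<Prod>i=1..n. lam i)"

end

theory Submission
  imports Defs
begin

text \<open>
  Collapsing is replaced by the stronger existence of a finite open cover of multiplicity at most
  \<open>n\<close> by sets inside the balls \<open>B(x, \<rho>(x))\<close>, whose nerve map is a
  collapse. The argument, by induction on \<open>n\<close>, follows Papasoglu's approach to Uryson
  width. Suppose every \<open>x\<close> has a ball of radius at most \<open>\<rho>(x)\<close> that
  is too small. Among all finite disjoint families of small open sets choose one whose complement
  \<open>Z\<close> has almost minimal \<open>(n - 1)\<close>-dimensional measure. If
  \<open>Z\<close> has a cover of multiplicity \<open>n - 1\<close>, then thickening it and adding
  the disjoint family covers \<open>X\<close> with multiplicity \<open>n\<close>. Otherwise the
  induction hypothesis gives a point of \<open>Z\<close> around which \<open>Z\<close> is large;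
  by almost minimality the spheres around this point are at least almost as large, and integrating
  over their radii with Eilenberg's inequality, whose constant is \<open>lam n\<close>, makes the
  balls in \<open>X\<close> large, a contradiction.
\<close>

section \<open>Hausdorff premeasures and measures: subadditivity and additivity on separated
  sets\<close>

lemma hausdorff_weight_mono:
  assumes "U \<subseteq> V" "bounded V"
  shows "hausdorff_weight n U \<le> hausdorff_weight n V"
proof (cases "U = {}")
  case False
  have "diameter U \<le> diameter V" "0 \<le> diameter U"
    using assms diameter_subset diameter_ge_0 bounded_subset by blast+
  with False assms show ?thesis
    by (auto simp: hausdorff_weight_def intro!: ennreal_leI mult_left_mono power_mono)
qed (simp add: hausdorff_weight_def)

lemma hausdorff_premeasure_le:
  assumes "A \<subseteq> (\<Union>i. U i)" "\<And>i. bounded (U i)" "\<And>i. diameter (U i) \<le> \<delta>"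
  shows "hausdorff_premeasure n \<delta> A \<le> (\<Sum>i. hausdorff_weight n (U i))"
  unfolding hausdorff_premeasure_def by (rule INF_lower) (use assms in auto)

lemma hausdorff_premeasure_less_cover:
  assumes "hausdorff_premeasure n \<delta> A < c"
  obtains U :: "nat \<Rightarrow> 'a::metric_space set"
  where "A \<subseteq> (\<Union>i. U i)" "\<And>i. bounded (U i)" "\<And>i. diameter (U i) \<le> \<delta>"
    "(\<Sum>i. hausdorff_weight n (U i)) < c"
  using assms unfolding hausdorff_premeasure_def INF_less_iff by auto

lemma hausdorff_premeasure_mono:
  "A \<subseteq> B \<Longrightarrow> \<delta>' \<le> \<delta> \<Longrightarrow> hausdorff_premeasure n \<delta> A \<le> hausdorff_premeasure n \<delta>' B"
  unfolding hausdorff_premeasure_def by (rule INF_superset_mono) (auto intro: order_trans)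

lemma hausdorff_measure_mono:
  "A \<subseteq> B \<Longrightarrow> hausdorff_measure n A \<le> hausdorff_measure n B"
  unfolding hausdorff_measure_def by (intro SUP_mono) (auto intro: hausdorff_premeasure_mono)

lemma incseq_hausdorff_premeasure:
  "incseq (\<lambda>k. hausdorff_premeasure n (inverse (real (Suc k))) A)"
  by (intro incseq_SucI hausdorff_premeasure_mono) (auto simp: field_simps)

text \<open>Premeasures grow as the scale shrinks, so the scales
  \<open>inverse (real (Suc k))\<close> suffice. Having a monotone sequence lets the supremum
  commute with sums and allows Fatou's lemma.\<close>

lemma hausdorff_measure_eq_SUP:
  "hausdorff_measure n A = (SUP k. hausdorff_premeasure n (inverse (real (Suc k))) A)"
  unfolding hausdorff_measure_def
proof (rule antisym)
  show "(SUP \<delta>\<in>{0<..}. hausdorff_premeasure n \<delta> A)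
      \<le> (SUP k. hausdorff_premeasure n (inverse (real (Suc k))) A)"
  proof (rule SUP_mono)
    fix \<delta> :: real assume "\<delta> \<in> {0<..}"
    then obtain k where "inverse (real (Suc k)) < \<delta>"
      using reals_Archimedean by auto
    then show "\<exists>k\<in>UNIV. hausdorff_premeasure n \<delta> A
        \<le> hausdorff_premeasure n (inverse (real (Suc k))) A"
      by (intro bexI[of _ k] hausdorff_premeasure_mono) auto
  qed
qed (auto intro!: SUP_mono)

text \<open>Even partial sums split exactly into partial sums of \<open>f\<close> and
  \<open>g\<close>. This prices the merging of two covers into a single sequence.\<close>

lemma suminf_interleave_le:
  fixes f g :: "nat \<Rightarrow> ennreal"
  shows "(\<Sum>i. if even i then f (i div 2) else g (i div 2)) \<le> (\<Sum>i. f i) + (\<Sum>i. g i)"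
proof (rule suminf_le_const[OF summableI])
  fix m
  let ?h = "\<lambda>i. if even i then f (i div 2) else g (i div 2)"
  have "sum ?h {..<m} \<le> sum ?h {..<2 * m}"
    by (intro sum_mono2) auto
  also have "\<dots> = (\<Sum>i<m. f i) + (\<Sum>i<m. g i)"
    by (induction m) (auto simp: algebra_simps)
  also have "\<dots> \<le> (\<Sum>i. f i) + (\<Sum>i. g i)"
    by (intro add_mono sum_le_suminf summableI) auto
  finally show "sum ?h {..<m} \<le> (\<Sum>i. f i) + (\<Sum>i. g i)" .
qed

lemma hausdorff_premeasure_Un:
  "hausdorff_premeasure n \<delta> (A \<union> B) \<le> hausdorff_premeasure n \<delta> A + hausdorff_premeasure n \<delta> B"
    (is "?l \<le> ?a + ?b")
proof (rule ennreal_le_epsilon)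
  fix e :: real assume e: "?a + ?b < top" "0 < e"
  have "?a < ?a + ennreal (e / 2)" "?b < ?b + ennreal (e / 2)"
    using e by (auto simp: ennreal_add_left_cancel_less[where b = 0, simplified])
  then obtain U V where
    U: "A \<subseteq> (\<Union>i. U i)" "\<And>i. bounded (U i)" "\<And>i. diameter (U i) \<le> \<delta>"
      "(\<Sum>i. hausdorff_weight n (U i)) < ?a + ennreal (e / 2)" and
    V: "B \<subseteq> (\<Union>i. V i)" "\<And>i. bounded (V i)" "\<And>i. diameter (V i) \<le> \<delta>"
      "(\<Sum>i. hausdorff_weight n (V i)) < ?b + ennreal (e / 2)"
    by (elim hausdorff_premeasure_less_cover) blast
  define W where "W = (\<lambda>i::nat. if even i then U (i div 2) else V (i div 2))"
  have UV: "U i \<subseteq> (\<Union>i. W i)" "V i \<subseteq> (\<Union>i. W i)" for i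
    using UN_upper[of "2 * i" UNIV W] UN_upper[of "2 * i + 1" UNIV W] by (auto simp: W_def)
  have "A \<union> B \<subseteq> (\<Union>i. W i)"
    by (intro Un_least order_trans[OF U(1)] order_trans[OF V(1)] UN_least UV)
  then have "?l \<le> (\<Sum>i. hausdorff_weight n (W i))"
    by (rule hausdorff_premeasure_le) (auto simp: W_def U V)
  also have "\<dots> \<le> (\<Sum>i. hausdorff_weight n (U i)) + (\<Sum>i. hausdorff_weight n (V i))"
    unfolding W_def if_distrib[of "hausdorff_weight n"] by (rule suminf_interleave_le)
  also have "\<dots> \<le> (?a + ennreal (e / 2)) + (?b + ennreal (e / 2))"
    using U V by (intro add_mono) auto
  also have "\<dots> = ?a + ?b + ennreal e"
    using e by (simp add: ac_simps flip: ennreal_plus)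
  finally show "?l \<le> ?a + ?b + ennreal e" .
qed

lemma hausdorff_measure_Un:
  "hausdorff_measure n (A \<union> B) \<le> hausdorff_measure n A + hausdorff_measure n B"
proof -
  have "hausdorff_measure n (A \<union> B) \<le> (SUP k. hausdorff_premeasure n (inverse (real (Suc k))) A
      + hausdorff_premeasure n (inverse (real (Suc k))) B)"
    unfolding hausdorff_measure_eq_SUP by (intro SUP_mono' hausdorff_premeasure_Un)
  then show ?thesis
    unfolding hausdorff_measure_eq_SUP
    by (simp only: ennreal_SUP_add[OF incseq_hausdorff_premeasure incseq_hausdorff_premeasure])
qed

lemma hausdorff_measure_empty [simp]: "hausdorff_measure n {} = 0"
proof -
  have "hausdorff_premeasure n \<delta> ({} :: 'a set) = 0" if "\<delta> > 0" for \<delta>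
    using hausdorff_premeasure_le[of "{}" "\<lambda>_. {}" \<delta> n] that
    by (simp add: hausdorff_weight_def)
  then show ?thesis
    by (simp add: hausdorff_measure_def)
qed

lemma hausdorff_measure_UN_finite:
  assumes "finite F" "\<And>i. i \<in> F \<Longrightarrow> hausdorff_measure n (A i) < top"
  shows "hausdorff_measure n (\<Union>i\<in>F. A i) < top"
  using assms
proof (induction F)
  case (insert x F)
  have "hausdorff_measure n (\<Union>i\<in>insert x F. A i)
      \<le> hausdorff_measure n (A x) + hausdorff_measure n (\<Union>i\<in>F. A i)"
    using hausdorff_measure_Un by simp
  also have "\<dots> < top" using insert by simp
  finally show ?case .
qed auto

text \<open>No set of diameter at most \<delta> meets both \<open>A\<close> and \<open>B\<close>.
  Intersecting a cover of the union with \<open>A\<close> and with \<open>B\<close> therefore counts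
  no weight twice.\<close>

lemma hausdorff_premeasure_separated:
  assumes "\<And>a b. a \<in> A \<Longrightarrow> b \<in> B \<Longrightarrow> \<delta> < dist a b"
  shows "hausdorff_premeasure n \<delta> A + hausdorff_premeasure n \<delta> B \<le> hausdorff_premeasure n \<delta> (A \<union> B)"
  unfolding hausdorff_premeasure_def[of n \<delta> "A \<union> B"]
proof (rule INF_greatest, clarify)
  fix U :: "nat \<Rightarrow> 'a set"
  assume U: "A \<union> B \<subseteq> (\<Union>i. U i)" "\<forall>i. bounded (U i) \<and> diameter (U i) \<le> \<delta>"
  have le: "hausdorff_premeasure n \<delta> C \<le> (\<Sum>i. hausdorff_weight n (U i \<inter> C))"
    if "C \<subseteq> A \<union> B" for C
  proof (rule hausdorff_premeasure_le)
    show "C \<subseteq> (\<Union>i. U i \<inter> C)" using that U by auto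
    show "bounded (U i \<inter> C)" for i using U by (auto intro: bounded_subset)
    show "diameter (U i \<inter> C) \<le> \<delta>" for i
      using U diameter_subset[of "U i \<inter> C" "U i"] by (auto intro: order_trans)
  qed
  have "hausdorff_weight n (U i \<inter> A) + hausdorff_weight n (U i \<inter> B) \<le> hausdorff_weight n (U i)" for i
  proof -
    have "U i \<inter> A = {} \<or> U i \<inter> B = {}"
      using assms U(2) diameter_bounded_bound[of "U i"] by (meson disjoint_iff IntE leD order_trans)
    then show ?thesis
      using hausdorff_weight_mono[of "U i \<inter> A" "U i" n] hausdorff_weight_mono[of "U i \<inter> B" "U i" n] U
      by (auto simp: hausdorff_weight_def[of n "{}"])
  qed
  then have "(\<Sum>i. hausdorff_weight n (U i \<inter> A) + hausdorff_weight n (U i \<inter> B))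
      \<le> (\<Sum>i. hausdorff_weight n (U i))"
    by (intro suminf_le summableI)
  then show "hausdorff_premeasure n \<delta> A + hausdorff_premeasure n \<delta> B \<le> (\<Sum>i. hausdorff_weight n (U i))"
    using add_mono[OF le[of A] le[of B]] by (simp add: suminf_add[OF summableI summableI])
qed

text \<open>Every scale below \<eta> separates the two sets, and small scales determine the measure.
  This property of metric outer measures takes the place of measurability in the exchange
  argument.\<close>

lemma hausdorff_measure_separated:
  assumes "\<eta> > 0" "\<And>a b. a \<in> A \<Longrightarrow> b \<in> B \<Longrightarrow> \<eta> \<le> dist a b"
  shows "hausdorff_measure n A + hausdorff_measure n B \<le> hausdorff_measure n (A \<union> B)"
proof -
  have "hausdorff_measure n A + hausdorff_measure n B
      = (SUP k. hausdorff_premeasure n (inverse (real (Suc k))) A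
          + hausdorff_premeasure n (inverse (real (Suc k))) B)"
    unfolding hausdorff_measure_eq_SUP
    by (simp only: ennreal_SUP_add[OF incseq_hausdorff_premeasure incseq_hausdorff_premeasure])
  also have "\<dots> \<le> hausdorff_measure n (A \<union> B)"
  proof (rule SUP_least)
    fix k
    define \<delta> where "\<delta> = min (inverse (real (Suc k))) (\<eta> / 2)"
    have "\<delta> < dist a b" if "a \<in> A" "b \<in> B" for a b
      using assms(2)[OF that] assms(1) by (auto simp: \<delta>_def)
    moreover have "\<delta> \<le> inverse (real (Suc k))" "\<delta> > 0"
      using assms(1) by (auto simp: \<delta>_def)
    ultimately have "hausdorff_premeasure n (inverse (real (Suc k))) A
          + hausdorff_premeasure n (inverse (real (Suc k))) B \<le> hausdorff_premeasure n \<delta> (A \<union> B)"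
      by (intro order_trans[OF add_mono hausdorff_premeasure_separated] hausdorff_premeasure_mono) auto
    also have "\<dots> \<le> hausdorff_measure n (A \<union> B)"
      unfolding hausdorff_measure_def by (rule SUP_upper) (simp add: \<open>\<delta> > 0\<close>)
    finally show "hausdorff_premeasure n (inverse (real (Suc k))) A
          + hausdorff_premeasure n (inverse (real (Suc k))) B \<le> hausdorff_measure n (A \<union> B)" .
  qed
  finally show ?thesis .
qed

text \<open>Every nonempty member of a cover has weight \<open>1\<close> in dimension 0. This is the
  volume bound for the base case of the induction.\<close>

lemma hausdorff_measure_0_ge:
  assumes "A \<noteq> {}"
  shows "1 \<le> hausdorff_measure 0 A"
proof -
  have "1 \<le> hausdorff_premeasure 0 1 A"
    unfolding hausdorff_premeasure_def
  proof (rule INF_greatest, clarify)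
    fix U :: "nat \<Rightarrow> 'a set" assume "A \<subseteq> (\<Union>i. U i)"
    with assms obtain i where "U i \<noteq> {}" by fastforce
    then have "1 = hausdorff_weight 0 (U i)" by (simp add: hausdorff_weight_def)
    also have "\<dots> = (\<Sum>i\<in>{i}. hausdorff_weight 0 (U i))" by simp
    also have "\<dots> \<le> (\<Sum>i. hausdorff_weight 0 (U i))"
      by (intro sum_le_suminf summableI) auto
    finally show "1 \<le> (\<Sum>i. hausdorff_weight 0 (U i))" .
  qed
  also have "\<dots> \<le> hausdorff_measure 0 A"
    unfolding hausdorff_measure_def by (rule SUP_upper) auto
  finally show ?thesis .
qed

section \<open>Eilenberg's inequality for 1-Lipschitz functions\<close>

lemma lam_Suc_pos: "0 < lam (Suc n)"
  by (simp add: lam_def unit_ball_vol_pos)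

text \<open>In Eilenberg's inequality each covering set casts an interval as its shadow under
  \<open>f\<close>. The length of this shadow is charged to one diameter factor of the
  weight.\<close>

lemma Sup_minus_Inf_le_diameter:
  fixes f :: "'a::metric_space \<Rightarrow> real"
  assumes "W \<noteq> {}" "bounded W" "1-lipschitz_on W f"
  shows "Sup (f ` W) - Inf (f ` W) \<le> diameter W"
    and "x \<in> W \<Longrightarrow> f x \<in> {Inf (f ` W)..Sup (f ` W)}"
proof -
  have d: "f x - f y \<le> diameter W" if "x \<in> W" "y \<in> W" for x y
    using lipschitz_onD[OF assms(3) that] diameter_bounded_bound[OF assms(2) that]
    by (simp add: dist_real_def)
  have "f x - diameter W \<le> Inf (f ` W)" if "x \<in> W" for x
    by (rule cINF_greatest) (use assms d that in \<open>auto simp: algebra_simps\<close>)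
  then have "Sup (f ` W) \<le> Inf (f ` W) + diameter W"
    by (intro cSUP_least) (use assms in \<open>auto simp: algebra_simps\<close>)
  then show "Sup (f ` W) - Inf (f ` W) \<le> diameter W" by simp
  assume x: "x \<in> W"
  have "bdd_below (f ` W)" "bdd_above (f ` W)"
    using d[OF x] d[OF _ x]
    by (auto intro!: bdd_belowI2[of _ "f x - diameter W"] bdd_aboveI2[of _ _ "f x + diameter W"]
        simp: algebra_simps)
  then show "f x \<in> {Inf (f ` W)..Sup (f ` W)}"
    using x by (auto intro: cINF_lower cSUP_upper)
qed

text \<open>The function \<open>g\<close> is arbitrary because \<open>t \<mapsto> \<H>\<^sub>n(A \<inter> f\<^sup>-\<^sup>1(t))\<close> need not be measurable.\<close>

lemma eilenberg_inequality:
  fixes f :: "'a::metric_space \<Rightarrow> real" and g :: "real \<Rightarrow> ennreal"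
  assumes f: "1-lipschitz_on A f"
    and [measurable]: "g \<in> borel_measurable borel"
    and g: "\<And>t. g t \<le> hausdorff_measure n {x \<in> A. f x = t}"
  shows "ennreal (lam (Suc n)) * (\<integral>\<^sup>+t. g t \<partial>lborel) \<le> hausdorff_measure (Suc n) A"
proof (cases "hausdorff_measure (Suc n) A = top")
  case False
  let ?H = "hausdorff_measure (Suc n) A"
  define \<delta> where "\<delta> k = inverse (real (Suc k))" for k
  have "\<exists>U. A \<subseteq> (\<Union>i. U i) \<and> (\<forall>i. bounded (U i) \<and> diameter (U i) \<le> \<delta> k) \<and>
      (\<Sum>i. hausdorff_weight (Suc n) (U i)) < ?H + ennreal (\<delta> k)" for k
  proof -
    have "hausdorff_premeasure (Suc n) (\<delta> k) A \<le> ?H"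
      unfolding hausdorff_measure_def by (rule SUP_upper) (auto simp: \<delta>_def)
    also have "\<dots> < ?H + ennreal (\<delta> k)"
      using False by (auto simp: \<delta>_def ennreal_add_left_cancel_less[where b = 0, simplified] less_top)
    finally show ?thesis by (elim hausdorff_premeasure_less_cover) blast
  qed
  then obtain U where U: "\<And>k. A \<subseteq> (\<Union>i. U k i)" "\<And>k i. bounded (U k i)"
      "\<And>k i. diameter (U k i) \<le> \<delta> k"
      "\<And>k. (\<Sum>i. hausdorff_weight (Suc n) (U k i)) < ?H + ennreal (\<delta> k)"
    by metis
  define W where "W k i = U k i \<inter> A" for k i :: nat
  have W: "bounded (W k i)" "W k i \<subseteq> A" "diameter (W k i) \<le> \<delta> k" for k i
    using U(2,3) diameter_subset[of "W k i" "U k i"]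
    by (auto simp: W_def intro: bounded_subset order_trans)
  \<comment> \<open>The shadow of a piece under \<open>f\<close>. Empty pieces are singled out
    because \<open>Inf {}\<close> and \<open>Sup {}\<close> on the reals say nothing.\<close>
  define J where "J k i = (if W k i = {} then {} else {Inf (f ` W k i)..Sup (f ` W k i)})" for k i
  \<comment> \<open>Adding the weights of the pieces whose shadow contains \<open>t\<close> gives a
    Borel function that dominates the premeasure of the fiber over \<open>t\<close>.\<close>
  define h where "h k t = (\<Sum>i. hausdorff_weight n (W k i) * indicator (J k i) t)" for k t
  have [measurable]: "J k i \<in> sets borel" for k i by (simp add: J_def)
  have [measurable]: "h k \<in> borel_measurable borel" for k
    unfolding h_def by measurable
  have weight: "ennreal (lam (Suc n)) * (hausdorff_weight n (W k i) * emeasure lborel (J k i))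
      \<le> hausdorff_weight (Suc n) (U k i)" for k i
  proof (cases "W k i = {}")
    case False
    have lip: "1-lipschitz_on (W k i) f" using f W(2) lipschitz_on_subset by blast
    have d0: "0 \<le> diameter (W k i)" using W(1) diameter_ge_0 by blast
    have JJ: "Inf (f ` W k i) \<le> Sup (f ` W k i)"
      using Sup_minus_Inf_le_diameter(2)[OF False W(1) lip] False by fastforce
    have J: "emeasure lborel (J k i) = ennreal (Sup (f ` W k i) - Inf (f ` W k i))"
      using JJ False by (simp add: J_def)
    have "ennreal (lam (Suc n)) * (hausdorff_weight n (W k i) * emeasure lborel (J k i))
       = ennreal (lam (Suc n) * (unit_ball_vol (real n) * (diameter (W k i) / 2) ^ n
            * (Sup (f ` W k i) - Inf (f ` W k i))))"
      unfolding J hausdorff_weight_def using False d0 JJ lam_Suc_pos[of n]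
      by (simp add: ennreal_mult less_imp_le)
    also have "\<dots> \<le> ennreal (lam (Suc n) * (unit_ball_vol (real n) * (diameter (W k i) / 2) ^ n
            * diameter (W k i)))"
      using lam_Suc_pos[of n] d0 Sup_minus_Inf_le_diameter(1)[OF False W(1) lip]
      by (intro ennreal_leI mult_left_mono) auto
    \<comment> \<open>This identity fixes the constant: the 2 in the denominator of
      \<open>lam\<close> turns the extra diameter into a radius, and the quotient of volumes
      exchanges the unit ball volume of dimension \<open>n\<close> for that of
      \<open>Suc n\<close>.\<close>
    also have "lam (Suc n) * (unit_ball_vol (real n) * (diameter (W k i) / 2) ^ n * diameter (W k i))
        = unit_ball_vol (real (Suc n)) * (diameter (W k i) / 2) ^ Suc n"
      using less_imp_neq[OF unit_ball_vol_pos[of "real n"]] by (simp add: lam_def)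
    also have "ennreal \<dots> = hausdorff_weight (Suc n) (W k i)"
      using False by (simp add: hausdorff_weight_def)
    also have "\<dots> \<le> hausdorff_weight (Suc n) (U k i)"
      by (rule hausdorff_weight_mono) (auto simp: W_def U)
    finally show ?thesis .
  qed (simp add: J_def)
  have int: "ennreal (lam (Suc n)) * (\<integral>\<^sup>+t. h k t \<partial>lborel) \<le> ?H + ennreal (\<delta> k)" for k
  proof -
    have "ennreal (lam (Suc n)) * (\<integral>\<^sup>+t. h k t \<partial>lborel)
        = (\<Sum>i. ennreal (lam (Suc n)) * (hausdorff_weight n (W k i) * emeasure lborel (J k i)))"
      unfolding h_def by (simp add: nn_integral_suminf nn_integral_cmult)
    also have "\<dots> \<le> (\<Sum>i. hausdorff_weight (Suc n) (U k i))"
      by (intro suminf_le weight summableI)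
    finally show ?thesis using U(4)[of k] by simp
  qed
  have pre: "hausdorff_premeasure n (\<delta> k) {x \<in> A. f x = t} \<le> h k t" for k t
  proof -
    define V where "V i = (if t \<in> J k i then W k i else {})" for i
    have "{x \<in> A. f x = t} \<subseteq> (\<Union>i. V i)"
    proof clarify
      fix x assume x: "x \<in> A" "t = f x"
      then obtain i where i: "x \<in> W k i" using U(1)[of k] by (auto simp: W_def)
      then have "f x \<in> J k i"
        using Sup_minus_Inf_le_diameter(2)[OF _ W(1)[of k i] lipschitz_on_subset[OF f W(2)] i]
        by (auto simp: J_def)
      then show "x \<in> (\<Union>i. V i)" using i x by (auto simp: V_def)
    qed
    then have "hausdorff_premeasure n (\<delta> k) {x \<in> A. f x = t} \<le> (\<Sum>i. hausdorff_weight n (V i))"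
      by (rule hausdorff_premeasure_le) (use W[of k] in \<open>auto simp: V_def \<delta>_def\<close>)
    also have "\<dots> = h k t"
      unfolding h_def by (intro suminf_cong) (auto simp: V_def hausdorff_weight_def)
    finally show ?thesis .
  qed
  have lim: "ennreal (lam (Suc n)) * g t \<le> liminf (\<lambda>k. ennreal (lam (Suc n)) * h k t)" for t
  proof -
    define p where "p k = ennreal (lam (Suc n)) * hausdorff_premeasure n (\<delta> k) {x \<in> A. f x = t}" for k
    have "incseq p"
      using incseq_hausdorff_premeasure[of n "{x \<in> A. f x = t}"]
      unfolding p_def \<delta>_def incseq_def by (auto intro: mult_left_mono)
    have "ennreal (lam (Suc n)) * g t \<le> (SUP k. p k)"
      using g[of t] unfolding p_def
      by (subst SUP_mult_left_ennreal[symmetric])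
        (auto simp: hausdorff_measure_eq_SUP \<delta>_def intro: mult_left_mono)
    also have "\<dots> = liminf p"
      using LIMSEQ_SUP[OF \<open>incseq p\<close>] by (simp add: lim_imp_Liminf)
    also have "\<dots> \<le> liminf (\<lambda>k. ennreal (lam (Suc n)) * h k t)"
      unfolding p_def by (intro Liminf_mono always_eventually allI mult_left_mono pre) auto
    finally show ?thesis .
  qed
  have "ennreal (lam (Suc n)) * (\<integral>\<^sup>+t. g t \<partial>lborel) = (\<integral>\<^sup>+t. ennreal (lam (Suc n)) * g t \<partial>lborel)"
    by (simp add: nn_integral_cmult)
  also have "\<dots> \<le> (\<integral>\<^sup>+t. liminf (\<lambda>k. ennreal (lam (Suc n)) * h k t) \<partial>lborel)"
    by (intro nn_integral_mono lim)
  \<comment> \<open>Fatou's lemma, applied as the scale of the covers tends to 0.\<close>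
  also have "\<dots> \<le> liminf (\<lambda>k. \<integral>\<^sup>+t. ennreal (lam (Suc n)) * h k t \<partial>lborel)"
    by (intro nn_integral_liminf) measurable
  also have "\<dots> \<le> liminf (\<lambda>k. ?H + ennreal (\<delta> k))"
    by (intro Liminf_mono always_eventually allI) (simp add: nn_integral_cmult int)
  also have "\<dots> = ?H"
  proof (rule lim_imp_Liminf)
    have "\<delta> \<longlonglongrightarrow> 0" unfolding \<delta>_def by (rule LIMSEQ_inverse_real_of_nat)
    then have "(\<lambda>k. ?H + ennreal (\<delta> k)) \<longlonglongrightarrow> ?H + ennreal 0"
      by (intro tendsto_add tendsto_const tendsto_ennrealI) auto
    then show "(\<lambda>k. ?H + ennreal (\<delta> k)) \<longlonglongrightarrow> ?H" by simp
  qed simp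
  finally show ?thesis .
qed auto

section \<open>From spheres to balls by integration over the radii\<close>

lemma nn_integral_power_greaterThanLessThan:
  assumes "0 \<le> r" "0 \<le> c"
  shows "(\<integral>\<^sup>+s. ennreal (c * s ^ n) * indicator {0<..<r} s \<partial>lborel) = ennreal (c * r ^ Suc n / Suc n)"
proof -
  have "AE s in lborel. s \<noteq> 0 \<and> s \<noteq> r"
    using AE_lborel_singleton[of 0] AE_lborel_singleton[of r] by eventually_elim auto
  then have "AE s in lborel. ennreal (c * s ^ n) * indicator {0<..<r} s
      = ennreal (c * s ^ n) * indicator {0..r} s"
    by eventually_elim (auto split: split_indicator)
  then have "(\<integral>\<^sup>+s. ennreal (c * s ^ n) * indicator {0<..<r} s \<partial>lborel)
      = (\<integral>\<^sup>+s. ennreal (c * s ^ n) * indicator {0..r} s \<partial>lborel)"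
    by (rule nn_integral_cong_AE)
  also have "\<dots> = ennreal (c * r ^ Suc n / Suc n - c * 0 ^ Suc n / Suc n)"
  proof (rule nn_integral_FTC_Icc)
    fix s
    show "((\<lambda>s. c * s ^ Suc n / Suc n) has_real_derivative c * s ^ n) (at s)"
      using DERIV_cmult[OF DERIV_pow[of "Suc n" s UNIV], of "c / Suc n"]
      by (simp del: of_nat_Suc power_Suc)
  qed (use assms in auto)
  finally show ?thesis by simp
qed

text \<open>One step of the induction on the dimension: \<open>lam (Suc n)\<close> is the constant
  of Eilenberg's inequality, and the division by \<open>Suc n\<close> comes from integrating
  \<open>s ^ n\<close>.\<close>

lemma c_const_Suc: "c_const (Suc n) = lam (Suc n) * c_const n / Suc n"
  by (simp add: c_const_def ac_simps)

lemma c_const_pos: "0 < c_const n"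
proof (induction n)
  case (Suc n)
  then show ?case using lam_Suc_pos[of n] by (simp add: c_const_Suc del: of_nat_Suc)
qed (simp add: c_const_def)

lemma lipschitz_on_dist: "1-lipschitz_on A (dist x)"
  by (rule lipschitz_onI)
    (auto simp: dist_real_def abs_le_iff dist_commute algebra_simps dist_triangle dist_triangle2 dist_triangle3)

text \<open>If all these spheres had infinite measure, Eilenberg's inequality for the distance from
  \<open>x\<close> would make the measure of the ball infinite.\<close>

lemma exists_sphere_finite_measure:
  fixes x :: "'a::metric_space"
  assumes "0 < r" "hausdorff_measure (Suc n) (X \<inter> ball x r) < top"
  obtains t where "0 < t" "t < r" "hausdorff_measure n {y \<in> X. dist x y = t} < top"
proof (rule ccontr)
  note obt = that
  assume "\<not> thesis"
  then have inf: "hausdorff_measure n {y \<in> X. dist x y = t} = top" if "0 < t" "t < r" for t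
    using obt[of t] that top.not_eq_extremum by blast
  have "{y \<in> X \<inter> ball x r. dist x y = t} = {y \<in> X. dist x y = t}" if "t < r" for t
    using that by auto
  then have "ennreal (lam (Suc n)) * (\<integral>\<^sup>+t. top * indicator {0<..<r} t \<partial>lborel)
      \<le> hausdorff_measure (Suc n) (X \<inter> ball x r)"
    by (intro eilenberg_inequality[OF lipschitz_on_dist[of _ x]]) (auto split: split_indicator simp: inf)
  also have "(\<integral>\<^sup>+t. top * indicator {0<..<r} t \<partial>lborel) = top"
    using assms(1) by (subst nn_integral_cmult_indicator) (simp_all add: ennreal_top_mult)
  finally show False
    using assms(2) lam_Suc_pos[of n] by (simp add: ennreal_mult_top top_unique)
qed

text \<open>The sphere bounds are integrated by Eilenberg's inequality for the distance from
  \<open>x\<close>. The error \<open>e\<close> occurs at all radii up to \<open>r\<close> and so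
  contributes \<open>e * r\<close>, scaled by \<open>lam (Suc n)\<close>.\<close>

lemma hausdorff_measure_ball_ge:
  fixes x :: "'a::metric_space"
  assumes "0 < r" "0 \<le> e"
    and "\<And>s. 0 < s \<Longrightarrow> s < r \<Longrightarrow>
      ennreal (c_const n * s ^ n) \<le> hausdorff_measure n {y \<in> X. dist x y = s} + ennreal e"
  shows "ennreal (c_const (Suc n) * r ^ Suc n)
    \<le> hausdorff_measure (Suc n) (X \<inter> ball x r) + ennreal (lam (Suc n) * (e * r))"
proof -
  let ?l = "ennreal (lam (Suc n))"
  \<comment> \<open>Truncated subtraction yields a measurable minorant of the sphere measures.
    Adding \<open>e\<close> back recovers at least the power of \<open>s\<close>.\<close>
  define g where "g s = (ennreal (c_const n * s ^ n) - ennreal e) * indicator {0<..<r} s" for s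
  have [measurable]: "g \<in> borel_measurable borel" unfolding g_def by measurable
  have "g s \<le> hausdorff_measure n {y \<in> X \<inter> ball x r. dist x y = s}" for s
  proof (cases "0 < s \<and> s < r")
    case True
    then have "{y \<in> X \<inter> ball x r. dist x y = s} = {y \<in> X. dist x y = s}" by auto
    with True assms(3)[of s] show ?thesis
      by (auto simp: g_def ennreal_minus_le_iff add.commute)
  qed (auto simp: g_def)
  then have le: "?l * (\<integral>\<^sup>+s. g s \<partial>lborel) \<le> hausdorff_measure (Suc n) (X \<inter> ball x r)"
    by (intro eilenberg_inequality[OF lipschitz_on_dist[of _ x]]) auto
  have diff: "a \<le> a - b + b" for a b :: ennreal
    using ennreal_minus_le_iff[of a b "a - b"] by (simp add: add.commute)
  have "ennreal (c_const (Suc n) * r ^ Suc n)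
      = ?l * (\<integral>\<^sup>+s. ennreal (c_const n * s ^ n) * indicator {0<..<r} s \<partial>lborel)"
    using assms(1) c_const_pos[of n] lam_Suc_pos[of n]
    by (simp add: nn_integral_power_greaterThanLessThan c_const_Suc flip: ennreal_mult)
  also have "\<dots> \<le> ?l * (\<integral>\<^sup>+s. g s + ennreal e * indicator {0<..<r} s \<partial>lborel)"
    by (intro mult_left_mono nn_integral_mono)
      (auto simp: g_def diff split: split_indicator)
  also have "\<dots> = ?l * (\<integral>\<^sup>+s. g s \<partial>lborel) + ?l * (ennreal e * ennreal r)"
    using assms(1) by (simp add: nn_integral_add nn_integral_cmult_indicator distrib_left)
  also have "\<dots> \<le> hausdorff_measure (Suc n) (X \<inter> ball x r) + ennreal (lam (Suc n) * (e * r))"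
    using assms lam_Suc_pos[of n] by (intro add_mono le) (simp add: ennreal_mult)
  finally show ?thesis .
qed

section \<open>Small packings and small covers\<close>

text \<open>Both openness and the center are taken relative to the set, so that the notion can also
  be applied to the complement of a packing.\<close>

definition small_open :: "'a::metric_space set \<Rightarrow> ('a \<Rightarrow> real) \<Rightarrow> 'a set \<Rightarrow> bool" where
  "small_open X \<rho> U \<longleftrightarrow> openin (top_of_set X) U \<and> (\<exists>x\<in>X. U \<subseteq> ball x (\<rho> x))"

definition small_packing :: "'a::metric_space set \<Rightarrow> ('a \<Rightarrow> real) \<Rightarrow> 'a set set \<Rightarrow> bool" where
  "small_packing X \<rho> \<O> \<longleftrightarrow> finite \<O> \<and> disjoint \<O> \<and> (\<forall>U\<in>\<O>. small_open X \<rho> U)"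

text \<open>Multiplicity at most \<open>k\<close> bounds the dimension of the nerve by
  \<open>k - 1\<close>. For \<open>k = 0\<close> only the empty set has such a cover, which starts
  the induction.\<close>

definition small_cover :: "nat \<Rightarrow> 'a::metric_space set \<Rightarrow> ('a \<Rightarrow> real) \<Rightarrow> 'a set set \<Rightarrow> bool" where
  "small_cover k X \<rho> \<W> \<longleftrightarrow> finite \<W> \<and> (\<forall>U\<in>\<W>. small_open X \<rho> U) \<and> X \<subseteq> \<Union>\<W> \<and>
     (\<forall>y\<in>X. card {U\<in>\<W>. y \<in> U} \<le> k)"

text \<open>The open ball becomes a new member and the old members lose the closed ball, which keeps
  them open and disjoint from it. The only points newly uncovered lie on the sphere.\<close>

lemma small_packing_insert_ball:
  assumes "small_packing X \<rho> \<O>" "x \<in> X" "r \<le> \<rho> x"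
  obtains \<O>' where "small_packing X \<rho> \<O>'"
    "X - \<Union>\<O>' \<subseteq> (X - \<Union>\<O> - ball x r) \<union> {y \<in> X. dist x y = r}"
proof
  let ?\<O>' = "insert (X \<inter> ball x r) ((\<lambda>U. U - cball x r) ` \<O>)"
  have "small_open X \<rho> (U - cball x r)" if "U \<in> \<O>" for U
  proof -
    have "openin (top_of_set X) (U \<inter> - cball x r)"
      using assms that by (intro openin_Int_open) (auto simp: small_packing_def small_open_def)
    moreover have "U - cball x r \<subseteq> U" by auto
    ultimately show ?thesis
      using assms that unfolding small_packing_def small_open_def Diff_eq by (meson order_trans)
  qed
  moreover have "small_open X \<rho> (X \<inter> ball x r)"
    unfolding small_open_def using assms by (auto simp: openin_open_Int intro!: bexI[of _ x])
  moreover have "disjoint ?\<O>'"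
    using assms(1) by (auto simp: small_packing_def pairwise_def disjnt_def)
  ultimately show "small_packing X \<rho> ?\<O>'"
    using assms(1) by (auto simp: small_packing_def)
  show "X - \<Union>?\<O>' \<subseteq> (X - \<Union>\<O> - ball x r) \<union> {y \<in> X. dist x y = r}"
    by auto
qed

text \<open>The balls are inserted one after another. When they cover \<open>X\<close>, what remains
  uncovered lies in finitely many spheres.\<close>

lemma small_packing_remove_balls:
  assumes "finite F" "F \<subseteq> X" "\<And>x. x \<in> F \<Longrightarrow> t x \<le> \<rho> x"
  shows "\<exists>\<O>. small_packing X \<rho> \<O> \<and>
    X - \<Union>\<O> \<subseteq> (X - (\<Union>x\<in>F. ball x (t x))) \<union> (\<Union>x\<in>F. {y \<in> X. dist x y = t x})"
  using assms
proof (induction F)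
  case empty
  show ?case by (rule exI[of _ "{}"]) (auto simp: small_packing_def)
next
  case (insert x F)
  then obtain \<O> where \<O>: "small_packing X \<rho> \<O>"
    "X - \<Union>\<O> \<subseteq> (X - (\<Union>x\<in>F. ball x (t x))) \<union> (\<Union>x\<in>F. {y \<in> X. dist x y = t x})"
    by auto
  obtain \<O>' where "small_packing X \<rho> \<O>'"
    "X - \<Union>\<O>' \<subseteq> (X - \<Union>\<O> - ball x (t x)) \<union> {y \<in> X. dist x y = t x}"
    using small_packing_insert_ball[OF \<O>(1), of x "t x"] insert.prems by auto
  with \<O>(2) show ?case by (intro exI[of _ \<O>']) auto
qed

text \<open>
  A set \<open>V\<close> of the cover is thickened to the points of \<open>X\<close> whose nearest points in \<open>Z\<close> all lie
  in \<open>V\<close>; passing to a nearest point shows that the multiplicity does not grow. The case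
  \<open>Z \<subseteq> V\<close> is separate because \<open>infdist y {} = 0\<close>.
\<close>

lemma small_cover_extend:
  assumes "compact Z" "Z \<subseteq> X" "small_cover k Z \<rho> \<V>"
  obtains \<W> where "finite \<W>" "\<And>U. U \<in> \<W> \<Longrightarrow> small_open X \<rho> U" "Z \<subseteq> \<Union>\<W>"
    "\<And>y. y \<in> X \<Longrightarrow> card {U\<in>\<W>. y \<in> U} \<le> k"
proof (cases "Z = {}")
  case True
  with that[of "{}"] show ?thesis by auto
next
  case False
  have V: "finite \<V>" "\<And>V. V \<in> \<V> \<Longrightarrow> openin (top_of_set Z) V" "Z \<subseteq> \<Union>\<V>"
    "\<And>V. V \<in> \<V> \<Longrightarrow> \<exists>x\<in>Z. V \<subseteq> ball x (\<rho> x)" "\<And>y. y \<in> Z \<Longrightarrow> card {V\<in>\<V>. y \<in> V} \<le> k"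
    using assms(3) by (auto simp: small_cover_def small_open_def)
  then obtain c where c: "\<And>V. V \<in> \<V> \<Longrightarrow> c V \<in> Z \<and> V \<subseteq> ball (c V) (\<rho> (c V))" by metis
  define D where "D V = (if Z \<subseteq> V then UNIV else {y. infdist y Z < infdist y (Z - V)})" for V
  define W where "W V = X \<inter> (ball (c V) (\<rho> (c V)) \<inter> D V)" for V
  have "open (D V)" for V
    by (auto simp: D_def intro!: open_Collect_less continuous_intros)
  then have small: "small_open X \<rho> (W V)" if "V \<in> \<V>" for V
    using c[OF that] assms(2) unfolding small_open_def W_def
    by (intro conjI openin_open_Int open_Int) auto
  have sub: "V \<subseteq> W V" if "V \<in> \<V>" for V
  proof
    fix z assume z: "z \<in> V"
    then have zZ: "z \<in> Z" using V(2)[OF that] openin_imp_subset by blast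
    have "closedin (top_of_set Z) (Z - V)" using V(2)[OF that] by (simp add: closedin_diff)
    then have cl: "closed (Z - V)"
      using assms(1) closedin_compact compact_imp_closed by blast
    have "z \<in> D V"
    proof (cases "Z \<subseteq> V")
      case False
      then have "infdist z (Z - V) \<noteq> 0"
        using in_closed_iff_infdist_zero[OF cl, of z] z by auto
      then show ?thesis
        using False zZ infdist_nonneg[of z "Z - V"] by (simp add: D_def)
    qed (simp add: D_def)
    then show "z \<in> W V" using z zZ c[OF that] assms(2) by (auto simp: W_def)
  qed
  show thesis
  proof (rule that[of "W ` \<V>"])
    fix y assume "y \<in> X"
    have "continuous_on Z (dist y)" by (intro continuous_intros)
    then obtain z where z: "z \<in> Z" "\<forall>w\<in>Z. dist y z \<le> dist y w"
      using continuous_attains_inf[OF assms(1) False] by blast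
    have "dist y z \<le> infdist y Z"
      using False z(2) by (auto simp: infdist_def intro: cINF_greatest)
    \<comment> \<open>If \<open>z\<close> were outside \<open>V\<close>, it would witness that
      \<open>Z - V\<close> is as close to \<open>y\<close> as \<open>Z\<close> is, against the
      definition of \<open>D\<close>.\<close>
    then have near: "z \<in> V" if "y \<in> W V" for V
      using that z(1) infdist_le[of z "Z - V" y] by (auto simp: W_def D_def split: if_splits)
    \<comment> \<open>Distinct sets may have the same thickening, which can only lower the
      count.\<close>
    have "card {U \<in> W ` \<V>. y \<in> U} \<le> card (W ` {V \<in> \<V>. z \<in> V})"
      using V(1) near by (intro card_mono) auto
    also have "\<dots> \<le> card {V \<in> \<V>. z \<in> V}" using V(1) by (intro card_image_le) auto
    also have "\<dots> \<le> k" using V(5) z(1) .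
    finally show "card {U \<in> W ` \<V>. y \<in> U} \<le> k" .
  next
    show "Z \<subseteq> \<Union>(W ` \<V>)" using V(3) sub by blast
  qed (use V(1) small in auto)
qed

text \<open>After thickening, a point lies in at most \<open>k\<close> sets of the cover of the
  complement, and disjointness lets the packing add at most one.\<close>

lemma small_cover_Suc:
  assumes "compact X" "small_packing X \<rho> \<O>" "small_cover k (X - \<Union>\<O>) \<rho> \<V>"
  shows "\<exists>\<W>. small_cover (Suc k) X \<rho> \<W>"
proof -
  have "closedin (top_of_set X) (X - \<Union>\<O>)"
    using assms(2) by (intro closedin_diff openin_Union) (auto simp: small_packing_def small_open_def)
  then have "compact (X - \<Union>\<O>)" using assms(1) closedin_compact by blast
  then obtain \<W> where W: "finite \<W>" "\<And>U. U \<in> \<W> \<Longrightarrow> small_open X \<rho> U" "X - \<Union>\<O> \<subseteq> \<Union>\<W>"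
    "\<And>y. y \<in> X \<Longrightarrow> card {U\<in>\<W>. y \<in> U} \<le> k"
    using small_cover_extend[OF _ _ assms(3)] by blast
  have O: "finite \<O>" "disjoint \<O>" using assms(2) by (auto simp: small_packing_def)
  have "card {U \<in> \<W> \<union> \<O>. y \<in> U} \<le> Suc k" if "y \<in> X" for y
  proof -
    have "{U \<in> \<W> \<union> \<O>. y \<in> U} = {U \<in> \<W>. y \<in> U} \<union> {U \<in> \<O>. y \<in> U}" by auto
    moreover have "card {U \<in> \<O>. y \<in> U} \<le> 1"
      using O by (auto simp: card_le_Suc0_iff_eq pairwise_def disjnt_def)
    ultimately show ?thesis
      using W(4)[OF that] card_Un_le[of "{U \<in> \<W>. y \<in> U}" "{U \<in> \<O>. y \<in> U}"] by simp
  qed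
  then show ?thesis
    using W O assms(2) by (intro exI[of _ "\<W> \<union> \<O>"]) (auto simp: small_cover_def small_packing_def)
qed

section \<open>The nerve map of a small cover\<close>

text \<open>Distances to the complements of the cover sets, normalized to a partition of unity,
  serve as barycentric coordinates. A fiber lies in each cover set whose coordinate is nonzero on
  it.\<close>

lemma small_cover_imp_rho_collapses:
  fixes X :: "'a::metric_space set"
  assumes "n \<ge> 1" "X \<noteq> {}" "small_cover n X \<rho> \<W>"
  shows "rho_collapses n X \<rho>"
proof -
  have W: "finite \<W>" "\<And>U. U \<in> \<W> \<Longrightarrow> openin (top_of_set X) U" "X \<subseteq> \<Union>\<W>"
    "\<And>U. U \<in> \<W> \<Longrightarrow> \<exists>x\<in>X. U \<subseteq> ball x (\<rho> x)" "\<And>y. y \<in> X \<Longrightarrow> card {U\<in>\<W>. y \<in> U} \<le> n"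
    using assms(3) by (auto simp: small_cover_def small_open_def)
  define m where "m = card \<W>"
  obtain h where h: "bij_betw h {..<m} \<W>"
    using ex_bij_betw_nat_finite[OF W(1)] unfolding atLeast0LessThan m_def by blast
  have hW: "h i \<in> \<W>" if "i < m" for i using h that by (auto simp: bij_betw_def)
  have cov: "\<exists>i<m. y \<in> h i" if y: "y \<in> X" for y
  proof -
    obtain U where "U \<in> \<W>" "y \<in> U" using y W(3) by auto
    moreover from this obtain i where "i < m" "U = h i" using h by (auto simp: bij_betw_def)
    ultimately show ?thesis by auto
  qed
  \<comment> \<open>A cover set containing all of \<open>X\<close> gets the value 1, since the
    distance to the empty set is 0 by convention and would make its coordinate vanish.\<close>
  define d where "d i y = (if X \<subseteq> h i then 1 else infdist y (X - h i))" for i y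
  define s where "s y = (\<Sum>i<m. d i y)" for y
  define \<pi> where "\<pi> y i = (if i < m then d i y / s y else 0)" for y i
  have d_nonneg: "0 \<le> d i y" for i y by (simp add: d_def infdist_nonneg)
  have d_pos: "d i y \<noteq> 0 \<longleftrightarrow> y \<in> h i" if "i < m" "y \<in> X" for i y
  proof (cases "X \<subseteq> h i")
    case False
    have "closedin (top_of_set X) (X - h i)" using W(2)[OF hW[OF that(1)]] by (simp add: closedin_diff)
    then obtain T where T: "closed T" "X - h i = X \<inter> T" by (auto simp: closedin_closed)
    have "closure (X - h i) \<subseteq> T" by (rule closure_minimal) (use T in auto)
    then have "y \<in> closure (X - h i) \<longleftrightarrow> y \<in> X - h i"
      using that(2) T(2) closure_subset[of "X - h i"] by auto
    moreover have "infdist y (X - h i) = 0 \<longleftrightarrow> y \<in> closure (X - h i)"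
      using False by (intro in_closure_iff_infdist_zero[symmetric]) auto
    ultimately show ?thesis using that False by (auto simp: d_def)
  qed (use that in \<open>auto simp: d_def\<close>)
  have s_pos: "0 < s y" if y: "y \<in> X" for y
  proof -
    obtain i where i: "i < m" "y \<in> h i" using cov[OF y] by auto
    then have "0 < d i y" using d_pos[OF i(1) y] d_nonneg[of i y] by simp
    then show ?thesis unfolding s_def using i d_nonneg by (intro sum_pos2[of _ i]) auto
  qed
  \<comment> \<open>A full skeleton containing the nerve is used instead of the nerve. The
    \<open>n\<close> additional vertices guarantee a simplex with exactly \<open>n\<close> vertices,
    as the complex must have dimension exactly \<open>n - 1\<close>.\<close>
  define K where "K = {\<sigma>. \<sigma> \<subseteq> {..<m + n} \<and> \<sigma> \<noteq> {} \<and> card \<sigma> \<le> n}"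
  have K: "finite_simplicial_n_complex (n - 1) K"
  proof -
    have "finite K" by (rule finite_subset[of _ "Pow {..<m + n}"]) (auto simp: K_def)
    moreover have fin: "finite \<sigma>" "\<sigma> \<noteq> {}" if "\<sigma> \<in> K" for \<sigma>
      using that finite_subset[of \<sigma> "{..<m + n}"] by (auto simp: K_def)
    moreover have "\<tau> \<in> K" if "\<sigma> \<in> K" "\<tau> \<subseteq> \<sigma> \<and> \<tau> \<noteq> {}" for \<tau> \<sigma>
      using that card_mono[OF fin(1)[OF that(1)], of \<tau>] by (auto simp: K_def)
    ultimately have "finite_simplicial_complex K"
      unfolding finite_simplicial_complex_def by blast
    moreover have "\<forall>\<sigma>\<in>K. card \<sigma> \<le> n - 1 + 1" by (auto simp: K_def)
    moreover have "{..<n} \<in> K" using assms(1) by (auto simp: K_def lessThan_empty_iff)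
    moreover have "card {..<n} = n - 1 + 1" using assms(1) by simp
    ultimately show ?thesis
      unfolding finite_simplicial_n_complex_def by blast
  qed
  have supp: "{i. \<pi> y i \<noteq> 0} = {i\<in>{..<m}. y \<in> h i}" if "y \<in> X" for y
    using s_pos[OF that] d_pos[OF _ that] by (auto simp: \<pi>_def)
  have "continuous_on X (\<lambda>y. \<pi> y i)" for i
  proof -
    have "continuous_on X (d j)" for j
      unfolding d_def by (cases "X \<subseteq> h j") (auto intro!: continuous_intros)
    moreover have "\<forall>y\<in>X. s y \<noteq> 0" using s_pos by force
    ultimately show ?thesis
      unfolding \<pi>_def s_def by (cases "i < m") (auto intro!: continuous_intros)
  qed
  then have "continuous_on X \<pi>" by (rule continuous_on_coordinatewise_then_product)
  moreover have "\<pi> y \<in> geometric_realization K" if y: "y \<in> X" for y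
  proof -
    have "{i\<in>{..<m}. y \<in> h i} \<in> K"
    proof -
      have "h ` {i\<in>{..<m}. y \<in> h i} \<subseteq> {U \<in> \<W>. y \<in> U}" using hW by auto
      moreover have "inj_on h {i\<in>{..<m}. y \<in> h i}"
        using h by (auto simp: bij_betw_def intro: inj_on_subset)
      ultimately have "card {i\<in>{..<m}. y \<in> h i} \<le> card {U \<in> \<W>. y \<in> U}"
        using W(1) by (intro card_inj_on_le) auto
      moreover have "{i\<in>{..<m}. y \<in> h i} \<noteq> {}"
        using cov[OF y] by auto
      ultimately show ?thesis using W(5)[OF y] by (auto simp: K_def)
    qed
    moreover have "(\<Sum>i\<in>{i. \<pi> y i \<noteq> 0}. \<pi> y i) = (\<Sum>i<m. \<pi> y i)"
      by (rule sum.mono_neutral_left) (auto simp: \<pi>_def)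
    moreover have "(\<Sum>i<m. \<pi> y i) = 1"
      using s_pos[OF y] by (simp add: \<pi>_def s_def flip: sum_divide_distrib)
    ultimately show ?thesis
      using supp[OF y] s_pos[OF y] d_nonneg by (auto simp: geometric_realization_def \<pi>_def)
  qed
  \<comment> \<open>Points outside the image have empty fibers, for which any center in the nonempty
    \<open>X\<close> will do.\<close>
  moreover have "\<exists>x\<in>X. {y \<in> X. \<pi> y = p} \<subseteq> X \<inter> ball x (\<rho> x)" for p
  proof (cases "{y \<in> X. \<pi> y = p} = {}")
    case False
    then obtain y where y: "y \<in> X" "\<pi> y = p" by auto
    then obtain i where i: "i < m" "y \<in> h i"
      using cov by blast
    then have "p i \<noteq> 0" using supp[OF y(1)] y(2) by blast
    then have "{y \<in> X. \<pi> y = p} \<subseteq> h i" using supp by blast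
    with W(4)[OF hW[OF i(1)]] show ?thesis by blast
  qed (use assms(2) in auto)
  ultimately show ?thesis unfolding rho_collapses_def using K by blast
qed

section \<open>Uniform choices by compactness\<close>

text \<open>A strict volume deficit survives a small decrease of the radius, and then a small shift
  of the center at fixed radius. A finite subcover makes the deficit and the bound on the radii
  uniform.\<close>

lemma uniform_volume_gap:
  fixes X :: "'a::metric_space set"
  assumes "compact X" "continuous_on X \<rho>" "c > 0" "X \<noteq> {}"
    and "\<And>x. x \<in> X \<Longrightarrow> \<exists>r. 0 < r \<and> r \<le> \<rho> x \<and> hausdorff_measure n (X \<inter> ball x r) < ennreal (c * r ^ n)"
  shows "\<exists>\<epsilon> R. 0 < \<epsilon> \<and> 0 < R \<and> (\<forall>x\<in>X. \<exists>r. 0 < r \<and> r < \<rho> x \<and> r \<le> R \<and>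
    hausdorff_measure n (X \<inter> ball x r) + ennreal \<epsilon> \<le> ennreal (c * r ^ n))"
proof -
  have "\<exists>\<delta> \<epsilon> r. 0 < \<delta> \<and> 0 < \<epsilon> \<and> 0 < r \<and> (\<forall>y\<in>X \<inter> ball x \<delta>. r < \<rho> y \<and>
      hausdorff_measure n (X \<inter> ball y r) + ennreal \<epsilon> \<le> ennreal (c * r ^ n))" if x: "x \<in> X" for x
  proof -
    obtain r where r: "0 < r" "r \<le> \<rho> x" "hausdorff_measure n (X \<inter> ball x r) < ennreal (c * r ^ n)"
      using assms(5)[OF x] by blast
    define v where "v = enn2real (hausdorff_measure n (X \<inter> ball x r))"
    have v: "hausdorff_measure n (X \<inter> ball x r) = ennreal v" "0 \<le> v"
      using r(3) by (auto simp: v_def ennreal_enn2real_if dest: order_less_trans[OF _ ennreal_less_top])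
    then have "v < c * r ^ n" using r(3) by (simp add: ennreal_less_iff)
    moreover have "((\<lambda>s. c * s ^ n) \<longlongrightarrow> c * r ^ n) (at_left r)" by (intro tendsto_intros)
    ultimately have "\<forall>\<^sub>F s in at_left r. v < c * s ^ n" by (rule order_tendstoD(1)[rotated])
    moreover have "\<forall>\<^sub>F s in at_left r. s \<in> {0<..<r}"
      using r(1) by (rule eventually_at_left_real)
    ultimately have "\<forall>\<^sub>F s in at_left r. v < c * s ^ n \<and> s \<in> {0<..<r}" by (rule eventually_conj)
    \<comment> \<open>The radius shrinks while \<open>c * s ^ n\<close> still exceeds the volume of
      the original ball. The slack \<open>r - s\<close> absorbs both the shift of the center and the
      variation of \<rho>.\<close>
    then obtain s where s: "v < c * s ^ n" "0 < s" "s < r"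
      using eventually_happens'[OF trivial_limit_at_left_real] by force
    obtain \<delta> where \<delta>: "0 < \<delta>" "\<And>y. y \<in> X \<Longrightarrow> dist y x < \<delta> \<Longrightarrow> \<bar>\<rho> y - \<rho> x\<bar> < r - s"
      using assms(2) x s(3) unfolding continuous_on_iff dist_real_def by (metis diff_gt_0_iff_gt)
    have "s < \<rho> y \<and> hausdorff_measure n (X \<inter> ball y s) + ennreal (c * s ^ n - v) \<le> ennreal (c * s ^ n)"
      if "y \<in> X \<inter> ball x (min \<delta> (r - s))" for y
    proof
      show "s < \<rho> y" using \<delta>(2)[of y] that r(2) by (auto simp: dist_commute)
      have "ball y s \<subseteq> ball x r"
      proof
        fix z assume "z \<in> ball y s"
        then show "z \<in> ball x r" using that dist_triangle[of x z y] by auto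
      qed
      then have "hausdorff_measure n (X \<inter> ball y s) \<le> ennreal v"
        unfolding v(1)[symmetric] by (intro hausdorff_measure_mono) auto
      then have "hausdorff_measure n (X \<inter> ball y s) + ennreal (c * s ^ n - v)
          \<le> ennreal v + ennreal (c * s ^ n - v)" by (rule add_right_mono)
      then show "hausdorff_measure n (X \<inter> ball y s) + ennreal (c * s ^ n - v) \<le> ennreal (c * s ^ n)"
        using v(2) s(1) by (simp flip: ennreal_plus)
    qed
    then show ?thesis
      using \<delta>(1) s by (intro exI[of _ "min \<delta> (r - s)"] exI[of _ "c * s ^ n - v"] exI[of _ s]) auto
  qed
  then obtain \<delta> \<epsilon> r where P: "\<And>x. x \<in> X \<Longrightarrow> 0 < \<delta> x \<and> 0 < \<epsilon> x \<and> 0 < r x \<and> (\<forall>y\<in>X \<inter> ball x (\<delta> x). r x < \<rho> y \<and>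
      hausdorff_measure n (X \<inter> ball y (r x)) + ennreal (\<epsilon> x) \<le> ennreal (c * r x ^ n))"
    by metis
  obtain F where F: "F \<subseteq> X" "finite F" "X \<subseteq> (\<Union>x\<in>F. ball x (\<delta> x))"
  proof (rule compactE_image[OF assms(1), of X "\<lambda>x. ball x (\<delta> x)"])
    show "X \<subseteq> (\<Union>x\<in>X. ball x (\<delta> x))" using P by (auto intro!: bexI)
  qed auto
  have "F \<noteq> {}" using F(3) assms(4) by auto
  show ?thesis
  proof (rule exI[of _ "Min (\<epsilon> ` F)"], rule exI[of _ "Max (r ` F)"], intro conjI ballI)
    show "0 < Min (\<epsilon> ` F)" using F P \<open>F \<noteq> {}\<close> by auto
    obtain x where "x \<in> F" using \<open>F \<noteq> {}\<close> by auto
    then have "0 < r x" "r x \<le> Max (r ` F)" using F(1,2) P by auto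
    then show "0 < Max (r ` F)" by simp
    fix y assume y: "y \<in> X"
    then obtain x where x: "x \<in> F" "y \<in> X \<inter> ball x (\<delta> x)" using F(3) by auto
    then have Px: "0 < r x" "r x < \<rho> y" "hausdorff_measure n (X \<inter> ball y (r x)) + ennreal (\<epsilon> x) \<le> ennreal (c * r x ^ n)"
      using P F(1) by blast+
    have "hausdorff_measure n (X \<inter> ball y (r x)) + ennreal (Min (\<epsilon> ` F)) \<le> ennreal (c * r x ^ n)"
      using x(1) F(2) by (intro order_trans[OF add_left_mono Px(3)] ennreal_leI) auto
    then show "\<exists>r'. 0 < r' \<and> r' < \<rho> y \<and> r' \<le> Max (r ` F) \<and>
       hausdorff_measure n (X \<inter> ball y r') + ennreal (Min (\<epsilon> ` F)) \<le> ennreal (c * r' ^ n)"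
      using Px x(1) F(2) by (intro exI[of _ "r x"]) auto
  qed
qed

text \<open>Finitely many balls bounded by spheres of finite measure cover \<open>X\<close>, and
  carving them out leaves only parts of these spheres. This makes the infimum over all packings
  finite, so that near-minimizers exist.\<close>

lemma small_packing_finite_measure:
  fixes X :: "'a::metric_space set"
  assumes "compact X"
    and "\<And>x. x \<in> X \<Longrightarrow> \<exists>r. 0 < r \<and> r < \<rho> x \<and> hausdorff_measure (Suc n) (X \<inter> ball x r) < top"
  obtains \<O> where "small_packing X \<rho> \<O>" "hausdorff_measure n (X - \<Union>\<O>) < top"
proof -
  have "\<exists>t. 0 < t \<and> t < \<rho> x \<and> hausdorff_measure n {y \<in> X. dist x y = t} < top" if x: "x \<in> X" for x
  proof -
    obtain r where r: "0 < r" "r < \<rho> x" "hausdorff_measure (Suc n) (X \<inter> ball x r) < top"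
      using assms(2)[OF x] by blast
    obtain t where "0 < t" "t < r" "hausdorff_measure n {y \<in> X. dist x y = t} < top"
      using exists_sphere_finite_measure[OF r(1,3)] .
    then show ?thesis using r(2) by (intro exI[of _ t]) auto
  qed
  then obtain t where t: "\<And>x. x \<in> X \<Longrightarrow> 0 < t x \<and> t x < \<rho> x \<and>
      hausdorff_measure n {y \<in> X. dist x y = t x} < top" by metis
  obtain F where F: "F \<subseteq> X" "finite F" "X \<subseteq> (\<Union>x\<in>F. ball x (t x))"
  proof (rule compactE_image[OF assms(1), of X "\<lambda>x. ball x (t x)"])
    show "X \<subseteq> (\<Union>x\<in>X. ball x (t x))" using t by (auto intro!: bexI)
  qed auto
  obtain \<O> where \<O>: "small_packing X \<rho> \<O>"
    "X - \<Union>\<O> \<subseteq> (X - (\<Union>x\<in>F. ball x (t x))) \<union> (\<Union>x\<in>F. {y \<in> X. dist x y = t x})"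
    using small_packing_remove_balls[OF F(2,1), of t \<rho>] t F(1) by (meson less_imp_le subsetD)
  have "hausdorff_measure n (X - \<Union>\<O>) \<le> hausdorff_measure n (\<Union>x\<in>F. {y \<in> X. dist x y = t x})"
    using \<O>(2) F(3) by (intro hausdorff_measure_mono) auto
  also have "\<dots> < top" using F t by (intro hausdorff_measure_UN_finite) auto
  finally show thesis using that \<O>(1) by blast
qed

text \<open>
  Exchanging the part of the complement inside a ball for the bounding sphere yields another
  packing. Comparing with a slightly smaller concentric ball separates the two parts by a positive
  distance, so that additivity of the outer measure needs no measurability.
\<close>

lemma sphere_measure_ge:
  fixes X :: "'a::metric_space set"
  assumes O: "small_packing X \<rho> \<O>" "hausdorff_measure n (X - \<Union>\<O>) < top"
    and min: "\<And>\<O>'. small_packing X \<rho> \<O>' \<Longrightarrow>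
      hausdorff_measure n (X - \<Union>\<O>) \<le> hausdorff_measure n (X - \<Union>\<O>') + ennreal e"
    and x: "x \<in> X" "s \<le> \<rho> x" "0 < s" and "0 \<le> c"
    and ball: "\<And>t. 0 < t \<Longrightarrow> t < s \<Longrightarrow> ennreal (c * t ^ n) \<le> hausdorff_measure n ((X - \<Union>\<O>) \<inter> ball x t)"
  shows "ennreal (c * s ^ n) \<le> hausdorff_measure n {y \<in> X. dist x y = s} + ennreal e"
    (is "_ \<le> ?S + _")
proof -
  let ?Z = "X - \<Union>\<O>"
  obtain \<O>' where \<O>': "small_packing X \<rho> \<O>'" "X - \<Union>\<O>' \<subseteq> (?Z - ball x s) \<union> {y \<in> X. dist x y = s}"
    using small_packing_insert_ball[OF O(1) x(1,2)] by blast
  \<comment> \<open>The part outside the ball occurs on both sides of the comparison; in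
    \<open>ennreal\<close> it can be cancelled because it is finite.\<close>
  have fin: "hausdorff_measure n (?Z - ball x s) < top"
    using O(2) hausdorff_measure_mono[of "?Z - ball x s" ?Z n] by auto
  have t: "ennreal (c * t ^ n) \<le> ?S + ennreal e" if "0 < t" "t < s" for t
  proof -
    have "s - t \<le> dist a b" if "a \<in> ?Z \<inter> ball x t" "b \<in> ?Z - ball x s" for a b
      using that dist_triangle[of x b a] by auto
    then have "hausdorff_measure n (?Z \<inter> ball x t) + hausdorff_measure n (?Z - ball x s)
        \<le> hausdorff_measure n ((?Z \<inter> ball x t) \<union> (?Z - ball x s))"
      using that by (intro hausdorff_measure_separated[of "s - t"]) auto
    also have "\<dots> \<le> hausdorff_measure n ?Z" by (rule hausdorff_measure_mono) auto
    also have "\<dots> \<le> hausdorff_measure n (X - \<Union>\<O>') + ennreal e" by (rule min[OF \<O>'(1)])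
    also have "\<dots> \<le> hausdorff_measure n (?Z - ball x s) + ?S + ennreal e"
      by (intro add_right_mono order_trans[OF hausdorff_measure_mono[OF \<O>'(2)] hausdorff_measure_Un])
    finally have "hausdorff_measure n (?Z \<inter> ball x t) \<le> ?S + ennreal e"
      using fin by (auto simp: ennreal_add_left_cancel_le add.assoc
          add.commute[of "hausdorff_measure n (?Z \<inter> ball x t)"])
    with ball[OF that] show ?thesis by (rule order_trans)
  qed
  have "((\<lambda>t. ennreal (c * t ^ n)) \<longlongrightarrow> ennreal (c * s ^ n)) (at_left s)"
    by (intro tendsto_intros)
  moreover have "\<forall>\<^sub>F t in at_left s. t \<in> {0<..<s}"
    using x(3) by (rule eventually_at_left_real)
  then have "\<forall>\<^sub>F t in at_left s. ennreal (c * t ^ n) \<le> ?S + ennreal e"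
    by eventually_elim (auto intro: t)
  ultimately show ?thesis
    by (rule tendsto_upperbound) simp
qed

section \<open>Induction on the dimension\<close>

text \<open>The statement is about compact subsets of a metric space, so that the induction
  hypothesis applies to the complement of a packing, with the same \<rho>.\<close>

lemma exists_large_balls:
  fixes X :: "'a::metric_space set"
  assumes "compact X" "continuous_on X \<rho>" "\<And>x. x \<in> X \<Longrightarrow> 0 < \<rho> x" "\<nexists>\<W>. small_cover n X \<rho> \<W>"
  shows "\<exists>x\<in>X. \<forall>r. 0 < r \<and> r \<le> \<rho> x \<longrightarrow>
    ennreal (c_const n * r ^ n) \<le> hausdorff_measure n (X \<inter> ball x r)"
  using assms
proof (induction n arbitrary: X)
  case 0
  then obtain x where "x \<in> X" by (force simp: small_cover_def)
  moreover from this have "1 \<le> hausdorff_measure 0 (X \<inter> ball x r)" if "0 < r" for r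
    using that by (intro hausdorff_measure_0_ge) auto
  ultimately show ?case by (auto simp: c_const_def)
next
  case (Suc n)
  show ?case
  proof (rule ccontr)
    assume neg: "\<not> ?case"
    have "X \<noteq> {}" using Suc.prems(4) by (force simp: small_cover_def)
    have small: "\<exists>r. 0 < r \<and> r \<le> \<rho> x \<and>
        hausdorff_measure (Suc n) (X \<inter> ball x r) < ennreal (c_const (Suc n) * r ^ Suc n)"
      if "x \<in> X" for x
      using neg that not_le by blast
    obtain \<epsilon> R where \<epsilon>: "0 < \<epsilon>" "0 < R" and gap: "\<forall>x\<in>X. \<exists>r. 0 < r \<and> r < \<rho> x \<and> r \<le> R \<and>
       hausdorff_measure (Suc n) (X \<inter> ball x r) + ennreal \<epsilon> \<le> ennreal (c_const (Suc n) * r ^ Suc n)"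
      using uniform_volume_gap[OF Suc.prems(1,2) c_const_pos[of "Suc n"] \<open>X \<noteq> {}\<close> small] by blast
    have fin: "hausdorff_measure (Suc n) (X \<inter> ball x r) < top"
      if "hausdorff_measure (Suc n) (X \<inter> ball x r) + ennreal \<epsilon> \<le> ennreal (c_const (Suc n) * r ^ Suc n)" for x r
      by (rule le_less_trans[OF order_trans[OF _ that] ennreal_less_top])
        (rule add_increasing2[OF zero_le order_refl])
    obtain \<O>\<^sub>0 where \<O>\<^sub>0: "small_packing X \<rho> \<O>\<^sub>0" "hausdorff_measure n (X - \<Union>\<O>\<^sub>0) < top"
    proof (rule small_packing_finite_measure[OF Suc.prems(1), of \<rho> n])
      show "\<exists>r. 0 < r \<and> r < \<rho> x \<and> hausdorff_measure (Suc n) (X \<inter> ball x r) < top" if x: "x \<in> X" for x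
      proof -
        obtain r where "0 < r" "r < \<rho> x"
          "hausdorff_measure (Suc n) (X \<inter> ball x r) + ennreal \<epsilon> \<le> ennreal (c_const (Suc n) * r ^ Suc n)"
          using gap x by blast
        then show ?thesis using fin[of x r] by (intro exI[of _ r]) auto
      qed
    qed
    define m where "m = (INF \<O>\<in>{\<O>. small_packing X \<rho> \<O>}. hausdorff_measure n (X - \<Union>\<O>))"
    \<comment> \<open>Chosen so that the integrated error \<open>lam (Suc n) * (e * r)\<close> stays
      at or below \<open>\<epsilon> / 2\<close> for all radii \<open>r \<le> R\<close>.\<close>
    define e where "e = \<epsilon> / (2 * lam (Suc n) * R)"
    have e: "0 < e" using \<epsilon> lam_Suc_pos[of n] by (simp add: e_def)
    have m: "m \<le> hausdorff_measure n (X - \<Union>\<O>)" if "small_packing X \<rho> \<O>" for \<O>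
      unfolding m_def by (rule INF_lower) (use that in simp)
    have "m < top" using m[OF \<O>\<^sub>0(1)] \<O>\<^sub>0(2) by auto
    then have "m < m + ennreal e"
      using e by (auto simp: ennreal_add_left_cancel_less[where b = 0, simplified])
    \<comment> \<open>A packing within \<open>e\<close> of the infimum replaces a minimizer, whose
      existence is not known.\<close>
    then obtain \<O> where \<O>: "small_packing X \<rho> \<O>" "hausdorff_measure n (X - \<Union>\<O>) < m + ennreal e"
      by (subst (asm) (1) m_def) (auto simp: INF_less_iff)
    let ?Z = "X - \<Union>\<O>"
    have Zfin: "hausdorff_measure n ?Z < top" using \<O>(2) \<open>m < top\<close> by (auto intro: order.strict_trans)
    have "closedin (top_of_set X) ?Z"
      using \<O>(1) by (intro closedin_diff openin_Union) (auto simp: small_packing_def small_open_def)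
    then have "compact ?Z" using Suc.prems(1) closedin_compact by blast
    moreover have "\<nexists>\<V>. small_cover n ?Z \<rho> \<V>"
      using small_cover_Suc[OF Suc.prems(1) \<O>(1)] Suc.prems(4) by blast
    ultimately obtain x where x: "x \<in> ?Z" "\<And>r. 0 < r \<Longrightarrow> r \<le> \<rho> x \<Longrightarrow>
        ennreal (c_const n * r ^ n) \<le> hausdorff_measure n (?Z \<inter> ball x r)"
      using Suc.IH[of ?Z] Suc.prems(2,3) continuous_on_subset[of X \<rho> ?Z] by auto
    obtain r where r: "0 < r" "r < \<rho> x" "r \<le> R"
       "hausdorff_measure (Suc n) (X \<inter> ball x r) + ennreal \<epsilon> \<le> ennreal (c_const (Suc n) * r ^ Suc n)"
      \<comment> \<open>The volume deficit is invoked at the very point around which the complement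
        is large.\<close>
      using gap x(1) by blast
    have "ennreal (c_const n * s ^ n) \<le> hausdorff_measure n {y \<in> X. dist x y = s} + ennreal e"
      if s: "0 < s" "s < r" for s
    proof (rule sphere_measure_ge[OF \<O>(1) Zfin])
      show "hausdorff_measure n ?Z \<le> hausdorff_measure n (X - \<Union>\<O>') + ennreal e"
        if "small_packing X \<rho> \<O>'" for \<O>'
        using \<O>(2) add_right_mono[OF m[OF that], of "ennreal e"] by (rule order_trans[OF less_imp_le])
    qed (use x s r c_const_pos[of n] in auto)
    then have "ennreal (c_const (Suc n) * r ^ Suc n)
        \<le> hausdorff_measure (Suc n) (X \<inter> ball x r) + ennreal (lam (Suc n) * (e * r))"
      using r(1) e by (intro hausdorff_measure_ball_ge) auto
    with r(4) have "hausdorff_measure (Suc n) (X \<inter> ball x r) + ennreal \<epsilon>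
        \<le> hausdorff_measure (Suc n) (X \<inter> ball x r) + ennreal (lam (Suc n) * (e * r))"
      by (rule order_trans)
    \<comment> \<open>The finite measure of the ball cancels, and the choice of \<open>e\<close>
      then bounds \<epsilon> by its half.\<close>
    then have "ennreal \<epsilon> \<le> ennreal (lam (Suc n) * (e * r))"
      using fin[OF r(4)] by (auto simp: ennreal_add_left_cancel_le)
    then have "\<epsilon> \<le> lam (Suc n) * (e * r)"
      using e r(1) lam_Suc_pos[of n] by (subst (asm) ennreal_le_iff) auto
    also have "\<dots> \<le> lam (Suc n) * (e * R)"
      using e r lam_Suc_pos[of n] by (intro mult_left_mono) auto
    also have "\<dots> = \<epsilon> / 2" using \<epsilon>(2) lam_Suc_pos[of n] by (simp add: e_def)
    finally show False using \<epsilon>(1) by simp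
  qed
qed

section \<open>Compactness of finite complexes and the conclusion for polyhedral spaces\<close>

text \<open>The realization is the finite union of its closed simplices. Each is a closed slice of a
  product of compact intervals and singletons, hence compact by Tychonoff's theorem.\<close>

lemma compact_geometric_realization:
  assumes "finite_simplicial_complex K"
  shows "compact (geometric_realization K)"
proof -
  define F where "F \<sigma> = (PiE UNIV (\<lambda>i. if i \<in> \<sigma> then {0..1} else {0}) :: (nat \<Rightarrow> real) set) \<inter> {f. sum f \<sigma> = 1}" for \<sigma>
  have fin: "finite \<sigma>" if "\<sigma> \<in> K" for \<sigma>
    using assms that by (auto simp: finite_simplicial_complex_def)
  have sum_eq: "sum f \<sigma> = (\<Sum>i\<in>{i. f i \<noteq> 0}. f i)" if "\<sigma> \<in> K" "{i. f i \<noteq> 0} \<subseteq> \<sigma>" for f :: "nat \<Rightarrow> real" and \<sigma>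
    by (rule sum.mono_neutral_right) (use fin[OF that(1)] that(2) in auto)
  have "geometric_realization K = (\<Union>\<sigma>\<in>K. F \<sigma>)"
  proof (intro equalityI subsetI)
    fix f assume f: "f \<in> geometric_realization K"
    let ?\<sigma> = "{i. f i \<noteq> 0}"
    have "f i \<le> 1" if "i \<in> ?\<sigma>" for i
      using f fin[of ?\<sigma>] member_le_sum[of i ?\<sigma> f] that by (simp add: geometric_realization_def)
    then have "f \<in> F ?\<sigma>" using f by (auto simp: F_def geometric_realization_def)
    then show "f \<in> (\<Union>\<sigma>\<in>K. F \<sigma>)" using f by (auto simp: geometric_realization_def)
  next
    fix f assume "f \<in> (\<Union>\<sigma>\<in>K. F \<sigma>)"
    then obtain \<sigma> where \<sigma>: "\<sigma> \<in> K" "sum f \<sigma> = 1" and f: "\<And>i. f i \<in> (if i \<in> \<sigma> then {0..1} else {0})"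
      by (auto simp: F_def PiE_iff)
    have "i \<in> \<sigma>" if "f i \<noteq> 0" for i using f[of i] that by (auto split: if_splits)
    then have sub: "{i. f i \<noteq> 0} \<subseteq> \<sigma>" by auto
    have "(\<Sum>i\<in>{i. f i \<noteq> 0}. f i) = 1" using sum_eq[OF \<sigma>(1) sub] \<sigma>(2) by simp
    \<comment> \<open>Coordinates summing to 1 cannot all vanish, so the support is a nonempty face
      of \<sigma> and closure under faces applies.\<close>
    moreover from this have "{i. f i \<noteq> 0} \<noteq> {}" by force
    then have "{i. f i \<noteq> 0} \<in> K"
      using assms \<sigma>(1) sub unfolding finite_simplicial_complex_def by blast
    moreover have "0 \<le> f i" for i using f[of i] by (auto split: if_splits)
    ultimately show "f \<in> geometric_realization K" by (simp add: geometric_realization_def)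
  qed
  moreover have "compact (F \<sigma>)" for \<sigma>
  proof -
    have "compact (PiE UNIV (\<lambda>i. if i \<in> \<sigma> then {0..1} else {0}) :: (nat \<Rightarrow> real) set)"
      unfolding compactin_euclidean_iff[symmetric] euclidean_product_topology[symmetric] compactin_PiE
      by simp
    moreover have "closed {f :: nat \<Rightarrow> real. sum f \<sigma> = 1}"
      by (intro closed_Collect_eq continuous_on_sum continuous_on_product_coordinates continuous_on_const)
    ultimately show ?thesis unfolding F_def by (rule compact_Int_closed)
  qed
  ultimately show ?thesis
    using assms by (auto simp: finite_simplicial_complex_def intro: compact_UN)
qed

theorem theorem1p7:
  fixes X :: "'a::metric_space set" and n :: nat and \<rho> :: "'a \<Rightarrow> real"
  assumes "n \<ge> 1"
    and "compact_polyhedral_length_space n X"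
    and "continuous_on X \<rho>"
    and "\<forall>x\<in>X. \<rho> x > 0"
    and "\<not> rho_collapses n X \<rho>"
  shows "\<exists>x\<^sub>0\<in>X. \<forall>r\<in>{0..\<rho> x\<^sub>0}.
           hausdorff_measure n (X \<inter> ball x\<^sub>0 r) \<ge> ennreal (c_const n * r ^ n)"
proof -
  obtain K where K: "finite_simplicial_n_complex n K" "X homeomorphic geometric_realization K"
    using assms(2) by (auto simp: compact_polyhedral_length_space_def)
  then have "compact X"
    using homeomorphic_compactness compact_geometric_realization
    by (auto simp: finite_simplicial_n_complex_def)
  \<comment> \<open>A complex of dimension \<open>n\<close> has a simplex, any vertex of which is a
    point of the realization. Thus \<open>X\<close> is nonempty, as the nerve map requires.\<close>
  have "geometric_realization K \<noteq> {}"
  proof -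
    obtain \<sigma> where \<sigma>: "\<sigma> \<in> K" "\<sigma> \<noteq> {}"
      using K(1) by (fastforce simp: finite_simplicial_n_complex_def)
    then obtain v where "v \<in> \<sigma>" by auto
    moreover have "\<forall>\<tau>. \<tau> \<subseteq> \<sigma> \<and> \<tau> \<noteq> {} \<longrightarrow> \<tau> \<in> K"
      using K(1) \<sigma>(1) unfolding finite_simplicial_n_complex_def finite_simplicial_complex_def by blast
    ultimately have "{v} \<in> K" by simp
    moreover have "{i. (if i = v then 1 else 0 :: real) \<noteq> 0} = {v}" by auto
    ultimately have "(\<lambda>i. if i = v then 1 else 0) \<in> geometric_realization K"
      unfolding geometric_realization_def by simp
    then show ?thesis by blast
  qed
  then have "X \<noteq> {}" using K(2) homeomorphic_empty by blast
  then have "\<nexists>\<W>. small_cover n X \<rho> \<W>"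
    using small_cover_imp_rho_collapses[OF assms(1)] assms(5) by blast
  then obtain x where x: "x \<in> X" "\<And>r. 0 < r \<Longrightarrow> r \<le> \<rho> x \<Longrightarrow>
      ennreal (c_const n * r ^ n) \<le> hausdorff_measure n (X \<inter> ball x r)"
    using exists_large_balls[OF \<open>compact X\<close> assms(3)] assms(4) by blast
  \<comment> \<open>At \<open>r = 0\<close> the lower bound is 0 because
    \<open>n \<ge> 1\<close>.\<close>
  have "ennreal (c_const n * r ^ n) \<le> hausdorff_measure n (X \<inter> ball x r)" if "r \<in> {0..\<rho> x}" for r
    using x(2)[of r] that assms(1) by (cases "r = 0") (auto simp: zero_power)
  with x(1) show ?thesis by blast
qed

end
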